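(* Let $u$ and $v$ be indeterminates and let \begin{align*} \widetilde{\alpha}_{k}^{u,v}(x):=\sum_{\ell=0}^{k}\genfrac{[}{]}{0pt}{}{k}{\ell}_{q}(u;q)_{\ell}\,v^{\ell}x^{k-\ell}=\sum_{\ell=0}^{k}\genfrac{[}{]}{0pt}{}{k}{\ell}_{q}(u;q)_{k-\ell}\,v^{k-\ell}x^{\ell}. \end{align*} Then \begin{equation*} H_{n}(\widetilde{\alpha}_{k}^{u,v}(x))=v^{\binom{n+1}{2}}q^{\binom{n+1}{3}}\prod_{j=1}^{n}(uv q^{j-1}-x)^{n+1-j}(u,q;q)_{n+1-j}. \end{equation*}
   Context: For a sequence $(a_k)_{k\ge0}$, $H_n(a_k):=\det_{0\le i,j\le n}(a_{i+j})$ denotes its $n$-th Hankel determinant. The $q$-Pochhammer symbol is $(A;q)_N:=\prod_{k=0}^{N-1}(1-Aq^k)$, with $(A_1,A_2;q)_N:=(A_1;q)_N(A_2;q)_N$, and the $q$-binomial coefficient is $\genfrac{[}{]}{0pt}{}{n}{k}_q:=\frac{(q;q)_n}{(q;q)_k(q;q)_{n-k}}$ for $0\le k\le n$ and $0$ otherwise. The polynomials $\widetilde{\alpha}_{k}^{u,v}(x)$ arise from the transform $\widetilde{\alpha}_{k}(x)=\sum_{\ell=0}^{k}q^{\binom{\ell}{2}}\genfrac{[}{]}{0pt}{}{k}{\ell}_{q}\alpha_{\ell}x^{k-\ell}$ with the choice $\alpha_{k}=q^{-\binom{k}{2}}(u;q)_{k}\,v^{k}$. *)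

theory Defs
  imports "Jordan_Normal_Form.Determinant"
begin

definition q_pochhammer :: "'a::comm_ring_1 \<Rightarrow> 'a \<Rightarrow> nat \<Rightarrow> 'a" where
  "q_pochhammer A q N = (\<Prod>k<N. 1 - A * q ^ k)"

definition q_pochhammer2 :: "'a::comm_ring_1 \<Rightarrow> 'a \<Rightarrow> 'a \<Rightarrow> nat \<Rightarrow> 'a" where
  "q_pochhammer2 A B q N = q_pochhammer A q N * q_pochhammer B q N"

(* Meaningful only if q^j is different from 1 for j = 1, ..., n; otherwise a denominator
   may vanish and the quotient is 0 by the library's convention. *)
definition q_binomial :: "'a::field \<Rightarrow> nat \<Rightarrow> nat \<Rightarrow> 'a" where
  "q_binomial q n k =
     (if k \<le> n
      then q_pochhammer q q n / (q_pochhammer q q k * q_pochhammer q q (n - k))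
      else 0)"

(* The matrix has size n + 1, with indices 0, ..., n. *)
definition hankel_det :: "nat \<Rightarrow> (nat \<Rightarrow> 'a::comm_ring_1) \<Rightarrow> 'a" where
  "hankel_det n a = det (mat (n + 1) (n + 1) (\<lambda>(i, j). a (i + j)))"

definition alpha_tilde :: "'a::field \<Rightarrow> 'a \<Rightarrow> 'a \<Rightarrow> nat \<Rightarrow> 'a \<Rightarrow> 'a" where
  "alpha_tilde q u v k x =
     (\<Sum>l=0..k. q_binomial q k l * q_pochhammer u q l * v ^ l * x ^ (k - l))"

end

theory Submission
  imports Defs
begin

text \<open>
  Let $L$ be the linear functional on polynomials in $t$ with moments $L(t^k) = a_k$, where $a_k$
  is the given sequence. The Hankel determinant of the moments equals
  $\det (L(\phi_i \psi_j))$ for any two families of monic polynomials with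
  $\deg \phi_i = \deg \psi_i = i$. For $\phi_m = \prod_{i<m} (t - x q^i)$ the $q$-binomial
  expansion of $t^k$ shows $L(\phi_m) = (u;q)_m v^m$, and for
  $\psi_j = \prod_{i<j} (t - v q^i)$ an induction on $j$ gives
  $L(\phi_m \psi_j) = (u;q)_m v^m q^{m j} \prod_{s<j} (x - u v q^s)$. Up to row and column
  factors this matrix is the Vandermonde matrix $(q^{m j})$.
\<close>

section \<open>Linear functionals given by their moments\<close>

definition moment_functional :: "(nat \<Rightarrow> 'a::comm_ring_1) \<Rightarrow> 'a poly \<Rightarrow> 'a" where
  "moment_functional a p = (\<Sum>k\<le>degree p. coeff p k * a k)"

text \<open>The summation range in the definition depends on \<open>p\<close>; a common bound
  \<open>N\<close> makes the sums for different polynomials comparable, which additivity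
  needs.\<close>

lemma moment_functional_bound:
  assumes "degree p \<le> N"
  shows "moment_functional a p = (\<Sum>k\<le>N. coeff p k * a k)"
  unfolding moment_functional_def
  by (rule sum.mono_neutral_left) (use assms in \<open>auto simp: coeff_eq_0\<close>)

lemma moment_functional_add:
  "moment_functional a (p + r) = moment_functional a p + moment_functional a r"
proof -
  let ?N = "max (degree p) (degree r)"
  have "degree (p + r) \<le> ?N" by (rule degree_add_le) auto
  then show ?thesis
    by (simp add: moment_functional_bound[where N = ?N] sum.distrib algebra_simps)
qed

lemma moment_functional_smult: "moment_functional a (smult c p) = c * moment_functional a p"
proof -
  have "degree (smult c p) \<le> degree p" by (rule degree_smult_le)
  then show ?thesis
    by (simp add: moment_functional_bound[where N = "degree p"] sum_distrib_left algebra_simps)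
qed

lemma moment_functional_sum:
  "moment_functional a (\<Sum>i\<in>I. f i) = (\<Sum>i\<in>I. moment_functional a (f i))"
  by (induction I rule: infinite_finite_induct)
    (auto simp: moment_functional_add, auto simp: moment_functional_def)

lemma moment_functional_monom: "moment_functional a (monom 1 k) = a k"
  by (subst moment_functional_bound[where N = k])
    (auto simp: degree_monom_le if_distrib[where f = "\<lambda>c. c * _"] cong: if_cong)

text \<open>For fixed \<open>p\<close> the values at p t^k form a moment sequence themselves, so a
  bilinear expression becomes a functional of \<open>r\<close> alone. This allows the basis to be
  changed in one factor at a time.\<close>

lemma moment_functional_mult:
  "moment_functional (\<lambda>k. moment_functional a (p * monom 1 k)) r = moment_functional a (p * r)"
proof -
  have "p * r = p * (\<Sum>k\<le>degree r. monom (coeff r k) k)"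
    by (simp add: poly_as_sum_of_monoms)
  also have "\<dots> = (\<Sum>k\<le>degree r. smult (coeff r k) (p * monom 1 k))"
    by (simp add: sum_distrib_left smult_monom flip: mult_smult_right)
  finally show ?thesis
    by (simp add: moment_functional_sum moment_functional_smult moment_functional_def[of _ r])
qed

lemma moment_functional_power: "moment_functional (\<lambda>k. y ^ k) p = poly p y"
  by (simp add: moment_functional_def poly_altdef)

section \<open>Determinants under change of basis and scaling\<close>

text \<open>The matrix is \<open>c\<close> times the matrix of coefficients of the
  \<open>f j\<close>, which is upper triangular with unit diagonal. Each row has its own functional,
  so the lemma covers both Hankel matrices and matrices of point evaluations.\<close>

lemma det_monic_basis:
  fixes c :: "nat \<Rightarrow> nat \<Rightarrow> 'a::comm_ring_1"
  assumes deg: "\<And>j. degree (f j) = j" and monic: "\<And>j. coeff (f j) j = 1"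
  shows "det (mat n n (\<lambda>(i, j). moment_functional (c i) (f j))) = det (mat n n (\<lambda>(i, j). c i j))"
proof -
  define F where "F = mat n n (\<lambda>(k, j). coeff (f j) k)"
  have F: "F \<in> carrier_mat n n" by (simp add: F_def)
  have "mat n n (\<lambda>(i, j). moment_functional (c i) (f j)) = mat n n (\<lambda>(i, j). c i j) * F"
  proof (rule eq_matI)
    fix i j assume "i < dim_row (mat n n (\<lambda>(i, j). c i j) * F)"
      and "j < dim_col (mat n n (\<lambda>(i, j). c i j) * F)"
    then have i: "i < n" and j: "j < n" by (auto simp: F_def)
    have "moment_functional (c i) (f j) = (\<Sum>k\<le>n - 1. coeff (f j) k * c i k)"
      by (rule moment_functional_bound) (use j deg in auto)
    \<comment> \<open>\<open>j < n\<close> excludes \<open>n = 0\<close>, where truncated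
      subtraction would make this false.\<close>
    also have "{..n - 1} = {0..<n}" using j by auto
    finally show "mat n n (\<lambda>(i, j). moment_functional (c i) (f j)) $$ (i, j)
        = (mat n n (\<lambda>(i, j). c i j) * F) $$ (i, j)"
      using i j by (simp add: F_def scalar_prod_def mult.commute)
  qed (auto simp: F_def)
  moreover have "det F = prod_list (diag_mat F)"
    by (rule det_upper_triangular[OF _ F]) (auto simp: F_def deg intro!: upper_triangularI coeff_eq_0)
  moreover have "prod_list (diag_mat F) = 1"
    by (simp add: prod_list_diag_prod F_def monic)
  ultimately show ?thesis
    using det_mult[OF _ F, of "mat n n (\<lambda>(i, j). c i j)"] by simp
qed

text \<open>The basis is changed in the columns first and, after transposition, in the rows. The two
  families may differ, since one will be adapted to \<open>x\<close> and the other to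
  \<open>v\<close>.\<close>

lemma det_hankel_monic_bases:
  fixes a :: "nat \<Rightarrow> 'a::comm_ring_1"
  assumes "\<And>j. degree (f j) = j" "\<And>j. coeff (f j) j = 1"
    and "\<And>j. degree (g j) = j" "\<And>j. coeff (g j) j = 1"
  shows "hankel_det n a =
    det (mat (n + 1) (n + 1) (\<lambda>(i, j). moment_functional a (f i * g j)))"
proof -
  have "det (mat (n + 1) (n + 1) (\<lambda>(i, j). moment_functional a (f i * g j)))
      = det (mat (n + 1) (n + 1)
          (\<lambda>(i, j). moment_functional (\<lambda>k. moment_functional a (f i * monom 1 k)) (g j)))"
    by (simp only: moment_functional_mult)
  also have "\<dots> = det (mat (n + 1) (n + 1) (\<lambda>(i, j). moment_functional a (f i * monom 1 j)))"
    by (rule det_monic_basis[OF assms(3,4)])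
  also have "\<dots> = det (transpose_mat
      (mat (n + 1) (n + 1) (\<lambda>(i, j). moment_functional a (f i * monom 1 j))))"
    by (rule det_transpose[where n = "n + 1", symmetric]) simp
  also have "transpose_mat
      (mat (n + 1) (n + 1) (\<lambda>(i, j). moment_functional a (f i * monom 1 j)))
      = mat (n + 1) (n + 1)
          (\<lambda>(i, j). moment_functional (\<lambda>k. moment_functional a (monom 1 i * monom 1 k)) (f j))"
    unfolding moment_functional_mult by (rule eq_matI) (auto simp: mult.commute)
  also have "det \<dots> = det (mat (n + 1) (n + 1)
      (\<lambda>(i, j). moment_functional a (monom 1 i * monom 1 j)))"
    by (rule det_monic_basis[OF assms(1,2)])
  finally show ?thesis
    by (simp add: hankel_det_def mult_monom moment_functional_monom)
qed

lemma det_scale_rows_cols: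
  fixes M :: "nat \<Rightarrow> nat \<Rightarrow> 'a::comm_ring_1"
  shows "det (mat n n (\<lambda>(i, j). r i * s j * M i j))
    = (\<Prod>i<n. r i) * (\<Prod>j<n. s j) * det (mat n n (\<lambda>(i, j). M i j))"
proof -
  let ?M = "mat n n (\<lambda>(i, j). M i j)"
  have diag: "det (mat_diag n d) = (\<Prod>i<n. d i)" for d :: "nat \<Rightarrow> 'a"
    by (subst det_upper_triangular[of _ n])
      (auto simp: mat_diag_def prod_list_diag_prod lessThan_atLeast0 intro!: upper_triangularI)
  have "mat n n (\<lambda>(i, j). r i * s j * M i j) = mat_diag n r * ?M * mat_diag n s"
    by (subst mat_diag_mult_left[of _ n n], simp, subst mat_diag_mult_right[of _ n n], simp)
      (auto intro!: eq_matI simp: ac_simps)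
  moreover have "det (mat_diag n r * ?M * mat_diag n s)
      = det (mat_diag n r) * det ?M * det (mat_diag n s)"
    by (subst det_mult[of _ n] | simp add: mult_carrier_mat[of _ n n])+
  ultimately show ?thesis
    by (simp add: diag mult.assoc mult.commute[of "det ?M"])
qed

section \<open>Products with roots in geometric progression\<close>

definition q_factors :: "'a::comm_ring_1 \<Rightarrow> 'a \<Rightarrow> nat \<Rightarrow> 'a poly" where
  "q_factors q y m = (\<Prod>i<m. [:- (y * q ^ i), 1:])"

lemma q_factors_0 [simp]: "q_factors q y 0 = 1"
  by (simp add: q_factors_def)

lemma q_factors_Suc: "q_factors q y (Suc m) = q_factors q y m * [:- (y * q ^ m), 1:]"
  by (simp add: q_factors_def)

lemma q_factors_monic:
  fixes q y :: "'a::idom"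
  shows degree_q_factors: "degree (q_factors q y m) = m"
    and coeff_q_factors: "coeff (q_factors q y m) m = 1"
proof -
  show d: "degree (q_factors q y m) = m" for m
    unfolding q_factors_def by (subst degree_prod_eq_sum_degree) auto
  have "lead_coeff (q_factors q y m) = 1"
    by (simp add: q_factors_def lead_coeff_prod)
  then show "coeff (q_factors q y m) m = 1" by (simp add: d)
qed

text \<open>This is a Vandermonde matrix with nodes q^i. Replacing t^j by the monic product that
  vanishes at 1, q, ..., q^(j-1) makes it lower triangular.\<close>

lemma det_q_power:
  fixes q :: "'a::idom"
  shows "det (mat n n (\<lambda>(i, j). q ^ (i * j))) = (\<Prod>j<n. (-1) ^ j * q ^ (j choose 2) * q_pochhammer q q j)"
proof -
  let ?A = "mat n n (\<lambda>(i, j). poly (q_factors q 1 j) (q ^ i))"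
  have "det (mat n n (\<lambda>(i, j). q ^ (i * j))) = det ?A"
    using det_monic_basis[of "q_factors q 1" n "\<lambda>i k. (q ^ i) ^ k"]
    by (simp add: q_factors_monic moment_functional_power power_mult)
  also have "\<dots> = prod_list (diag_mat ?A)"
    by (rule det_lower_triangular[where n = n]) (auto simp: q_factors_def poly_prod)
  also have "\<dots> = (\<Prod>j<n. poly (q_factors q 1 j) (q ^ j))"
    by (simp add: prod_list_diag_prod lessThan_atLeast0)
  also have "\<dots> = (\<Prod>j<n. (-1) ^ j * q ^ (j choose 2) * q_pochhammer q q j)"
  proof (rule prod.cong[OF refl])
    fix j :: nat
    have "poly (q_factors q 1 j) (q ^ j) = (\<Prod>i<j. q ^ j - q ^ i)"
      by (simp add: q_factors_def poly_prod)
    \<comment> \<open>The exponent j - i is split as 1 + (j - \<open>Suc i\<close>), so that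
      reversing the index yields a Pochhammer symbol.\<close>
    also have "\<dots> = (\<Prod>i<j. - 1 * q ^ i * (1 - q * q ^ (j - Suc i)))"
      by (rule prod.cong[OF refl]) (auto simp: algebra_simps simp flip: power_add power_Suc)
    also have "\<dots> = (- 1) ^ j * (\<Prod>i<j. q ^ i) * (\<Prod>i<j. 1 - q * q ^ (j - Suc i))"
      by (simp only: prod.distrib) simp
    also have "(\<Prod>i<j. 1 - q * q ^ (j - Suc i)) = q_pochhammer q q j"
      unfolding q_pochhammer_def by (rule prod.nat_diff_reindex)
    also have "(\<Prod>i<j. q ^ i) = q ^ (j choose 2)"
      by (induction j) (auto simp: numeral_2_eq_2 power_add)
    finally show "poly (q_factors q 1 j) (q ^ j) = (-1) ^ j * q ^ (j choose 2) * q_pochhammer q q j" .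
  qed
  finally show ?thesis .
qed

lemma q_pochhammer_Suc: "q_pochhammer y q (Suc n) = q_pochhammer y q n * (1 - y * q ^ n)"
  by (simp add: q_pochhammer_def)

section \<open>The q-binomial expansion and the transformed moments\<close>

context
  fixes q :: "'a::field"
  assumes q: "\<And>m::nat. m \<ge> 1 \<Longrightarrow> q ^ m \<noteq> 1"
begin

lemma q_pochhammer_nonzero: "q_pochhammer q q n \<noteq> 0"
  using q[of "Suc _"] by (auto simp: q_pochhammer_def)

lemma q_binomial_0: "q_binomial q n 0 = 1"
  using q_pochhammer_nonzero by (simp add: q_binomial_def q_pochhammer_def[of _ _ 0])

lemma q_binomial_self: "q_binomial q n n = 1"
  using q_pochhammer_nonzero by (simp add: q_binomial_def q_pochhammer_def[of _ _ 0])

text \<open>Of the two q-Pascal rules, this one carries the power of \<open>q\<close> that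
  multiplication by t produces in the basis \<open>q_factors q x\<close>.\<close>

lemma q_binomial_Suc_Suc:
  "q_binomial q (Suc n) (Suc k) = q_binomial q n k + q ^ Suc k * q_binomial q n (Suc k)"
proof (cases "k < n")
  case True
  \<comment> \<open>This substitution removes truncated subtraction and exposes the extra factors of
    each Pochhammer symbol.\<close>
  then obtain d where d: "n = Suc (k + d)" using less_iff_Suc_add by auto
  have nz: "1 - q * q ^ m \<noteq> 0" for m using q[of "Suc m"] by simp
  show ?thesis
    using q_pochhammer_nonzero nz
    by (simp add: d q_binomial_def q_pochhammer_Suc[of _ _ "k + d"] q_pochhammer_Suc[of _ _ "Suc (k + d)"]
        q_pochhammer_Suc[of _ _ d] q_pochhammer_Suc[of _ _ k] divide_simps)
      (simp add: algebra_simps power_add)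
next
  case False
  then consider "n = k" | "n < k" by linarith
  then show ?thesis
    by cases (simp_all add: q_binomial_self, simp_all add: q_binomial_def)
qed

text \<open>A q-analogue of expanding (x + (t - x))^k. Multiplication by t sends the basis element
  of index l to that of index l + 1 plus x q^l times itself; the q-Pascal rule merges the two
  contributions.\<close>

lemma monom_eq_sum_q_factors:
  "monom 1 k = (\<Sum>l\<le>k. smult (q_binomial q k l * x ^ (k - l)) (q_factors q x l))"
proof (induction k)
  case 0
  then show ?case by (simp add: q_binomial_0 monom_0)
next
  case (Suc k)
  let ?B = "q_binomial q"
  have step: "monom 1 (Suc 0) * q_factors q x l = q_factors q x (Suc l) + smult (x * q ^ l) (q_factors q x l)" for l
    by (simp add: q_factors_Suc monom_altdef algebra_simps)
  have "monom 1 (Suc k) = monom 1 (Suc 0) * monom (1::'a) k" by (simp add: mult_monom)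
  also have "\<dots> = (\<Sum>l\<le>k. smult (?B k l * x ^ (k - l)) (monom 1 (Suc 0) * q_factors q x l))"
    by (simp add: Suc sum_distrib_left)
  also have "\<dots> = (\<Sum>l\<le>k. smult (?B k l * x ^ (k - l)) (q_factors q x (Suc l)))
      + (\<Sum>l\<le>k. smult (q ^ l * ?B k l * x ^ (Suc k - l)) (q_factors q x l))"
    by (simp add: step smult_add_right sum.distrib Suc_diff_le ac_simps)
  \<comment> \<open>The added term vanishes because \<open>q_binomial q k (Suc k)\<close> is 0;
    after splitting off l = 0 the two sums have the same range.\<close>
  also have "(\<Sum>l\<le>k. smult (q ^ l * ?B k l * x ^ (Suc k - l)) (q_factors q x l))
      = (\<Sum>l\<le>Suc k. smult (q ^ l * ?B k l * x ^ (Suc k - l)) (q_factors q x l))"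
    by (simp add: q_binomial_def[of _ k "Suc k"])
  also have "\<dots> = smult (x ^ Suc k) 1
      + (\<Sum>l\<le>k. smult (q ^ Suc l * ?B k (Suc l) * x ^ (k - l)) (q_factors q x (Suc l)))"
    by (subst sum.atMost_Suc_shift) (simp add: q_binomial_0)
  also have "(\<Sum>l\<le>k. smult (?B k l * x ^ (k - l)) (q_factors q x (Suc l))) + \<dots>
      = smult (x ^ Suc k) 1
        + (\<Sum>l\<le>k. smult (?B (Suc k) (Suc l) * x ^ (k - l)) (q_factors q x (Suc l)))"
    by (simp add: q_binomial_Suc_Suc smult_add_left sum.distrib algebra_simps)
  also have "\<dots> = (\<Sum>l\<le>Suc k. smult (?B (Suc k) l * x ^ (Suc k - l)) (q_factors q x l))"
    by (subst sum.atMost_Suc_shift) (simp add: q_binomial_0)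
  finally show ?case .
qed

text \<open>Applying the functional to the expansion of t^m gives the sum defining
  \<open>alpha_tilde\<close>, with the unknown values in place of (u;q)_l v^l. This system is
  triangular with unit diagonal, so strong induction isolates the term l = m.\<close>

lemma moment_functional_q_factors:
  "moment_functional (\<lambda>k. alpha_tilde q u v k x) (q_factors q x m) = q_pochhammer u q m * v ^ m"
proof (induction m rule: less_induct)
  case (less m)
  let ?L = "moment_functional (\<lambda>k. alpha_tilde q u v k x)"
  have "?L (monom 1 m) = (\<Sum>l\<le>m. q_binomial q m l * x ^ (m - l) * ?L (q_factors q x l))"
    by (subst monom_eq_sum_q_factors[of _ x]) (simp add: moment_functional_sum moment_functional_smult)
  then have "(\<Sum>l\<le>m. q_binomial q m l * x ^ (m - l) * ?L (q_factors q x l))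
      = (\<Sum>l\<le>m. q_binomial q m l * x ^ (m - l) * (q_pochhammer u q l * v ^ l))"
    by (simp add: moment_functional_monom alpha_tilde_def atMost_atLeast0 ac_simps)
  then show ?case
    using less by (simp add: q_binomial_self flip: lessThan_Suc_atMost)
qed

text \<open>Write t - v q^j = (t - x q^m) + (x q^m - v q^j). The first part raises \<open>m\<close>,
  so the induction leaves \<open>m\<close> arbitrary; its contribution v q^j (1 - u q^m) cancels the
  term - v q^j and leaves q^m (x - u v q^j).\<close>

lemma moment_functional_q_factors_mult:
  "moment_functional (\<lambda>k. alpha_tilde q u v k x) (q_factors q x m * q_factors q v j)
    = q_pochhammer u q m * v ^ m * (\<Prod>s<j. x - u * v * q ^ s) * q ^ (m * j)"
proof (induction j arbitrary: m)
  case 0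
  then show ?case by (simp add: moment_functional_q_factors)
next
  case (Suc j)
  have "q_factors q x m * q_factors q v (Suc j)
      = q_factors q x (Suc m) * q_factors q v j
        + smult (x * q ^ m - v * q ^ j) (q_factors q x m * q_factors q v j)"
    by (simp add: q_factors_Suc algebra_simps smult_diff_left)
  then show ?case
    by (simp only: moment_functional_add moment_functional_smult Suc.IH)
      (simp add: q_pochhammer_Suc power_add algebra_simps)
qed

lemma hankel_det_alpha_tilde:
  "hankel_det n (\<lambda>k. alpha_tilde q u v k x) =
    (\<Prod>m<n + 1. q_pochhammer u q m * v ^ m) * (\<Prod>j<n + 1. \<Prod>s<j. x - u * v * q ^ s)
    * (\<Prod>j<n + 1. (-1) ^ j * q ^ (j choose 2) * q_pochhammer q q j)"
  by (subst det_hankel_monic_bases[of "q_factors q x" "q_factors q v"])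
    (simp_all only: q_factors_monic moment_functional_q_factors_mult
      det_scale_rows_cols det_q_power)

end

section \<open>Rearranging products and the final evaluation\<close>

text \<open>On both sides \<open>f s\<close> occurs n - s times, once for each j with s < j \<le>
  n.\<close>

lemma prod_power_staircase:
  fixes f :: "nat \<Rightarrow> 'a::comm_monoid_mult"
  shows "(\<Prod>j=1..n. f (j - 1) ^ (n + 1 - j)) = (\<Prod>j<n + 1. \<Prod>s<j. f s)"
proof (induction n)
  case (Suc n)
  have "(\<Prod>j=1..Suc n. f (j - 1) ^ (Suc n + 1 - j))
      = (\<Prod>j=1..Suc n. f (j - 1) ^ (n + 1 - j) * f (j - 1))"
    by (rule prod.cong[OF refl]) (auto simp: Suc_diff_le simp flip: power_Suc2)
  also have "\<dots> = (\<Prod>j=1..n. f (j - 1) ^ (n + 1 - j)) * (\<Prod>j=1..Suc n. f (j - 1))"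
    by (simp add: prod.distrib ac_simps)
  also have "(\<Prod>j=1..Suc n. f (j - 1)) = (\<Prod>s<Suc n. f s)"
    by (rule prod.reindex_bij_witness[of _ Suc "\<lambda>j. j - 1"]) auto
  finally show ?case using Suc by simp
qed simp

text \<open>The hockey-stick identity in the exponent, applied below with k = 1 and k = 2.\<close>

lemma power_sum_eq:
  fixes q :: "'a::comm_monoid_mult"
  shows "(\<Prod>j<n + 1. q ^ (j choose k)) = q ^ ((n + 1) choose Suc k)"
  by (induction n) (auto simp: power_add ac_simps)

theorem theorem4p3:
  fixes q u v x :: "'a::field" and n :: nat
  assumes q_not_root_of_unity: "\<And>m::nat. m \<ge> 1 \<Longrightarrow> q ^ m \<noteq> 1"
  shows "(\<forall>k. alpha_tilde q u v k x =
            (\<Sum>l=0..k. q_binomial q k l * q_pochhammer u q (k - l) * v ^ (k - l) * x ^ l))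
       \<and> hankel_det n (\<lambda>k. alpha_tilde q u v k x) =
           v ^ ((n + 1) choose 2) * q ^ ((n + 1) choose 3) *
           (\<Prod>j=1..n. (u * v * q ^ (j - 1) - x) ^ (n + 1 - j) *
                      q_pochhammer2 u q q (n + 1 - j))"
proof (intro conjI allI)
  fix k
  show "alpha_tilde q u v k x =
      (\<Sum>l=0..k. q_binomial q k l * q_pochhammer u q (k - l) * v ^ (k - l) * x ^ l)"
    unfolding alpha_tilde_def
    \<comment> \<open>Reversal of the sum combines with the symmetry of the q-binomial
      coefficient.\<close>
    by (subst sum.atLeastAtMost_rev, rule sum.cong[OF refl]) (auto simp: q_binomial_def ac_simps)
next
  \<comment> \<open>The sign from reversing these differences cancels the sign (-1)^j of the
    Vandermonde factor.\<close>
  have neg: "(\<Prod>s<j. x - u * v * q ^ s) = (-1) ^ j * (\<Prod>s<j. u * v * q ^ s - x)" for j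
    using prod.distrib[of "\<lambda>_. -1" "\<lambda>s. u * v * q ^ s - x" "{..<j}"] by simp
  have sign: "(-1) ^ j * ((-1) ^ j * y) = (y::'a)" for j y
    by (simp flip: mult.assoc power_mult_distrib)
  \<comment> \<open>After the reversal the index 0 can be added, since its factor is an empty
    product.\<close>
  have "(\<Prod>j=1..n. q_pochhammer2 u q q (n + 1 - j)) = (\<Prod>j=1..n. q_pochhammer2 u q q j)"
    by (subst prod.atLeastAtMost_rev) (rule prod.cong, auto)
  also have "\<dots> = (\<Prod>j<n + 1. q_pochhammer2 u q q j)"
    by (simp add: prod.lessThan_Suc_shift prod.atLeast1_atMost_eq q_pochhammer2_def
        q_pochhammer_def[of _ _ 0] del: prod.lessThan_Suc)
  finally have poch: "(\<Prod>j=1..n. q_pochhammer2 u q q (n + 1 - j))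
      = (\<Prod>j<n + 1. q_pochhammer u q j) * (\<Prod>j<n + 1. q_pochhammer q q j)"
    by (simp only: q_pochhammer2_def prod.distrib)
  have "hankel_det n (\<lambda>k. alpha_tilde q u v k x) =
      (\<Prod>m<n + 1. q_pochhammer u q m * v ^ m) * (\<Prod>j<n + 1. \<Prod>s<j. x - u * v * q ^ s)
      * (\<Prod>j<n + 1. (-1) ^ j * q ^ (j choose 2) * q_pochhammer q q j)"
    using q_not_root_of_unity by (rule hankel_det_alpha_tilde)
  \<comment> \<open>The power v^j is written with \<open>j choose 1\<close> so that
    \<open>power_sum_eq\<close> handles the powers of \<open>v\<close> and of \<open>q\<close>
    alike.\<close>
  also have "\<dots> =
      (\<Prod>j<n + 1. v ^ (j choose 1) * q ^ (j choose 2) * (\<Prod>s<j. u * v * q ^ s - x)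
        * (q_pochhammer u q j * q_pochhammer q q j))"
    unfolding prod.distrib[symmetric]
    by (rule prod.cong[OF refl]) (simp only: neg, simp add: sign ac_simps)
  finally show "hankel_det n (\<lambda>k. alpha_tilde q u v k x) =
           v ^ ((n + 1) choose 2) * q ^ ((n + 1) choose 3) *
           (\<Prod>j=1..n. (u * v * q ^ (j - 1) - x) ^ (n + 1 - j) *
                      q_pochhammer2 u q q (n + 1 - j))"
    unfolding prod.distrib poch prod_power_staircase[of "\<lambda>s. u * v * q ^ s - x"] power_sum_eq
    by (simp add: numeral_2_eq_2 numeral_3_eq_3 ac_simps)
qed

end
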